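(* Let the sequence $\{(\mathbf w_t,\mathbf D_t,\boldsymbol\mu_t,\mathbf z_t)\}_{t\ge1}$ be generated by the saddle-point dynamics with Laplacian averaging (defined in the context), with any sequence of learning rates $\{\eta_t\}_{t\ge1}\subset\mathbb R_{>0}$, over a sequence of arbitrary weight-balanced digraphs $\{\mathcal G_t\}_{t\ge1}$ on $\{1,\dots,N\}$ such that $\sup_{t\ge1}\sigma_{\max}(\mathsf L_t)\le\overline\Lambda$, and with consensus stepsize $\sigma>0$ satisfying $\sigma\le\big(\max\{d_{\mathrm{out},t}(k): k\in\{1,\dots,N\},\,t\in\mathbb Z_{\ge1}\}\big)^{-1}$. Then for any saddle point $(\mathbf w^*,\mathbf D^*,\boldsymbol\mu^*,\mathbf z^* )$ of $\phi$ on $S$ with $\mathbf D^*=(D^*,\dots,D^* )$ and $\mathbf z^*=(z^*,\dots,z^* )$ for some $(D^*,z^* )\in\mathcal D\times\mathcal Z$, and for every $t\ge1$, $$-\mathsf u(t,\boldsymbol\mu^*,\mathbf z^* )-\mathsf u(t,\mathbf w_{t+1}^{\mathrm{av}},\mathbf D_{t+1}^{\mathrm{av}})\le 2t\,\phi(\mathbf w_{t+1}^{\mathrm{av}},\mathbf D_{t+1}^{\mathrm{av}},\boldsymbol\mu_{t+1}^{\mathrm{av}},\mathbf z_{t+1}^{\mathrm{av}})-2t\,\phi(\mathbf w^*,\mathbf D^*,\boldsymbol\mu^*,\mathbf z^* )\le\mathsf u(t,\mathbf w^*,\mathbf D^* )+\mathsf u(t,\boldsymbol\mu_{t+1}^{\mathrm{av}},\mathbf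 z_{t+1}^{\mathrm{av}}),$$ where, for $(\mathbf w_p,\mathbf D_p)\in\mathcal W\times\mathcal D^N$, $$\begin{aligned}\mathsf u(t,\mathbf w_p,\mathbf D_p)=&\sum_{s=2}^t\big(\|\mathbf w_s-\mathbf w_p\|_2^2+\|\mathbf M\mathbf D_s-\mathbf D_p\|_2^2\big)\Big(\tfrac1{\eta_s}-\tfrac1{\eta_{s-1}}\Big)+\tfrac2{\eta_1}\big(\|\mathbf w_1\|_2^2+\|\mathbf w_p\|_2^2+\|\mathbf D_1\|_2^2+\|\mathbf D_p\|_2^2\big)\\&+6\sum_{s=1}^t\eta_s\big(\|g_{\mathbf w_s}\|_2^2+\|g_{\mathbf D_s}\|_2^2\big)+2(2+\sigma\overline\Lambda)\sum_{s=1}^t\|g_{\mathbf D_s}\|_2\|\mathbf L_{\mathcal K}\mathbf D_s\|_2+2\|\mathbf L_{\mathcal K}\mathbf D_p\|_2\sum_{s=1}^t\|g_{\mathbf D_s}\|_2,\end{aligned}$$ and, for $(\boldsymbol\mu_p,\mathbf z_p)\in\mathcal M\times\mathcal Z^N$, $\mathsf u(t,\boldsymbol\mu_p,\mathbf z_p)$ is the same expression with $\mathbf w_p,\mathbf D_p,\mathbf w_s,\mathbf D_s,g_{\mathbf w_s},g_{\mathbf D_s}$ replaced by $\boldsymbol\mu_p,\mathbf z_p,\boldsymbol\mu_s,\mathbf z_s,g_{\boldsymbol\mu_s},g_{\mathbf z_s}$, respectively.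
   Context: **Saddle-point data.** $\mathcal W\subseteq\mathbb R^{d_w}$, $\mathcal D\subseteq\mathbb R^{d_D}$, $\mathcal M\subseteq\mathbb R^{d_\mu}$, $\mathcal Z\subseteq\mathbb R^{d_z}$ are closed convex sets, $S:=\mathcal W\times\mathcal D^N\times\mathcal M\times\mathcal Z^N$, and $\phi:S\to\mathbb R$, $(\mathbf w,\mathbf D,\boldsymbol\mu,\mathbf z)\mapsto\phi(\mathbf w,\mathbf D,\boldsymbol\mu,\mathbf z)$, is jointly convex in $(\mathbf w,\mathbf D)$ and jointly concave in $(\boldsymbol\mu,\mathbf z)$; $\mathbf D=(D^1,\dots,D^N)$ and $\mathbf z=(z^1,\dots,z^N)$. A saddle point of $\phi$ on $S$ is a point $(\mathbf w^*,\mathbf D^*,\boldsymbol\mu^*,\mathbf z^* )\in S$ with $\phi(\mathbf w^*,\mathbf D^*,\boldsymbol\mu,\mathbf z)\le\phi(\mathbf w^*,\mathbf D^*,\boldsymbol\mu^*,\mathbf z^* )\le\phi(\mathbf w,\mathbf D,\boldsymbol\mu^*,\mathbf z^* )$ for all $(\mathbf w,\mathbf D,\boldsymbol\mu,\mathbf z)\in S$. **Graphs.** A weighted digraph $\mathcal G_t$ on $\{1,\dots,N\}$ is given by an entrywise nonnegative adjacency matrix $\mathsf A_t=(\mathsf a_{ij,t})\in\mathbb R^{N\times N}$. $d_{\mathrm{out},t}(i)=\sum_j\mathsf a_{ij,t}$; the Laplacian is $\mathsf L_t=\mathrm{diag}(\mathsf A_t\mathbf 1_N)-\mathsf A_t$;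 $\mathcal G_t$ is weight-balanced if $\sum_j\mathsf a_{ij,t}=\sum_j\mathsf a_{ji,t}$ for all $i$. $\sigma_{\max}$ is the largest singular value. With $d=d_D$ or $d=d_z$ according to the vector multiplied: $\mathbf L_t=\mathsf L_t\otimes I_d$, $\mathbf M=\frac1N\mathbf 1_N\mathbf 1_N^\top\otimes I_d$, $\mathbf L_{\mathcal K}=(I_N-\frac1N\mathbf 1_N\mathbf 1_N^\top)\otimes I_d$. **Dynamics.** Given an initial point in $S$, a consensus stepsize $\sigma>0$ and learning rates $\eta_t>0$, $$\hat{\mathbf w}_{t+1}=\mathbf w_t-\eta_tg_{\mathbf w_t},\quad \hat{\mathbf D}_{t+1}=\mathbf D_t-\sigma\mathbf L_t\mathbf D_t-\eta_tg_{\mathbf D_t},\quad \hat{\boldsymbol\mu}_{t+1}=\boldsymbol\mu_t+\eta_tg_{\boldsymbol\mu_t},\quad \hat{\mathbf z}_{t+1}=\mathbf z_t-\sigma\mathbf L_t\mathbf z_t+\eta_tg_{\mathbf z_t},$$ $$(\mathbf w_{t+1},\mathbf D_{t+1},\boldsymbol\mu_{t+1},\mathbf z_{t+1})=\mathcal P_S(\hat{\mathbf w}_{t+1},\hat{\mathbf D}_{t+1},\hat{\boldsymbol\mu}_{t+1},\hat{\mathbf z}_{t+1}),$$ where $\mathcal P_S$ is the Euclidean orthogonal projection onto $S$. Here $g_{\mathbf w_t}\in\partial_{\mathbf w}\phi$, $g_{\mathbf D_t}\in\partial_{\mathbf D}\phi$, $g_{\boldsymbol\mu_t}\in\partial_{\boldsymbol\mu}\phi$,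 $g_{\mathbf z_t}\in\partial_{\mathbf z}\phi$, all evaluated at $(\mathbf w_t,\mathbf D_t,\boldsymbol\mu_t,\mathbf z_t)$, where $\partial_{\mathbf w},\partial_{\mathbf D},\partial_{\boldsymbol\mu},\partial_{\mathbf z}$ denote the set of subgradients with respect to the indicated argument (a vector $\xi$ is a subgradient of a concave $f$ at $x$ if $-\xi$ is a subgradient of the convex function $-f$ at $x$). **Running time-averages.** For $t\ge1$, $\mathbf w_{t+1}^{\mathrm{av}}=\frac1t\sum_{s=1}^t\mathbf w_s$, and likewise $\mathbf D_{t+1}^{\mathrm{av}},\boldsymbol\mu_{t+1}^{\mathrm{av}},\mathbf z_{t+1}^{\mathrm{av}}$.
   Formalization: The subgradients (g_w, g_D) are taken as a joint subgradient of φ in (w, D), and (g_μ, g_z) as a joint one in (μ, z), not as separate partial subgradients; with separate ones the bound fails, e.g. for φ = 2|w−D| − w − D on [0,1]². *)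

theory Defs
  imports "HOL-Analysis.Analysis"
begin

definition agent_product :: "'a set \<Rightarrow> ('a ^ 'n) set" where
  "agent_product C = {X. \<forall>i. X $ i \<in> C}"

definition out_degree :: "real ^ 'n ^ 'n \<Rightarrow> 'n \<Rightarrow> real" where
  "out_degree A i = (\<Sum>j\<in>UNIV. A $ i $ j)"

definition laplacian :: "real ^ 'n ^ 'n \<Rightarrow> real ^ 'n ^ 'n" where
  "laplacian A = (\<chi> i j. if i = j then (A *v 1) $ i else 0) - A"

definition weight_balanced :: "real ^ 'n ^ 'n \<Rightarrow> bool" where
  "weight_balanced A \<longleftrightarrow> (\<forall>i. (\<Sum>j\<in>UNIV. A $ i $ j) = (\<Sum>j\<in>UNIV. A $ j $ i))"

definition singular_values :: "real ^ 'n ^ 'm \<Rightarrow> real set" where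
  "singular_values A =
     {s. 0 \<le> s \<and> (\<exists>v. v \<noteq> 0 \<and> (transpose A ** A) *v v = s\<^sup>2 *\<^sub>R v)}"

definition sigma_max :: "real ^ 'n ^ 'm \<Rightarrow> real" where
  "sigma_max A = Max (singular_values A)"

text \<open>The action of the Kronecker product \<open>B \<otimes> I\<^sub>d\<close> on a stacked vector
  \<open>X = (X\<^sup>1, \<dots>, X\<^sup>N)\<close>; the blocks of \<open>X\<close> are kept as the entries of a vector of vectors,
  whose norm is the Euclidean norm of the stacked vector.\<close>

definition kron_id :: "real ^ 'n ^ 'n \<Rightarrow> 'a::real_vector ^ 'n \<Rightarrow> 'a ^ 'n" where
  "kron_id B X = (\<chi> i. \<Sum>j\<in>UNIV. B $ i $ j *\<^sub>R X $ j)"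

definition averaging_matrix :: "real ^ 'n ^ 'n" where
  "averaging_matrix = (\<chi> i j. 1 / real CARD('n))"

definition avg_op :: "'a::real_vector ^ 'n \<Rightarrow> 'a ^ 'n" where
  "avg_op = kron_id averaging_matrix"

definition disagreement_op :: "'a::real_vector ^ 'n \<Rightarrow> 'a ^ 'n" where
  "disagreement_op = kron_id (mat 1 - averaging_matrix)"

definition subgradients :: "'a::real_inner set \<Rightarrow> ('a \<Rightarrow> real) \<Rightarrow> 'a \<Rightarrow> 'a set" where
  "subgradients C f x = {\<xi>. \<forall>y\<in>C. f x + \<xi> \<bullet> (y - x) \<le> f y}"

definition concave_subgradients :: "'a::real_inner set \<Rightarrow> ('a \<Rightarrow> real) \<Rightarrow> 'a \<Rightarrow> 'a set" where
  "concave_subgradients C f x = {\<xi>. - \<xi> \<in> subgradients C (\<lambda>y. - f y) x}"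

text \<open>The subgradients used by the dynamics are the two blocks of a joint subgradient in
  \<open>(w, D)\<close> (respectively \<open>(\<mu>, z)\<close>). By the next two lemmas each block is a subgradient with
  respect to its own argument. The converse fails for nonsmooth functions: for
  \<open>f w D = 2 * \<bar>w - D\<bar> - w - D\<close> on \<open>{0..1} \<times> {0..1}\<close>, \<open>0\<close> is a subgradient at \<open>(0, 0)\<close> with
  respect to each argument separately, although the minimum is attained only at \<open>(1, 1)\<close>.\<close>

lemma subgradients_blocks:
  assumes "(\<xi>, \<zeta>) \<in> subgradients (X \<times> Y) (\<lambda>(x, y). f x y) (x, y)" and "x \<in> X" and "y \<in> Y"
  shows "\<xi> \<in> subgradients X (\<lambda>x'. f x' y) x" and "\<zeta> \<in> subgradients Y (\<lambda>y'. f x y') y"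
proof -
  have *: "f x y + (\<xi> \<bullet> (x' - x) + \<zeta> \<bullet> (y' - y)) \<le> f x' y'" if "x' \<in> X" "y' \<in> Y" for x' y'
    using assms(1) that by (auto simp: subgradients_def)
  show "\<xi> \<in> subgradients X (\<lambda>x'. f x' y) x"
    using *[OF _ \<open>y \<in> Y\<close>] by (simp add: subgradients_def)
  show "\<zeta> \<in> subgradients Y (\<lambda>y'. f x y') y"
    using *[OF \<open>x \<in> X\<close>] by (simp add: subgradients_def)
qed

lemma concave_subgradients_blocks:
  assumes "(\<xi>, \<zeta>) \<in> concave_subgradients (X \<times> Y) (\<lambda>(x, y). f x y) (x, y)"
    and "x \<in> X" and "y \<in> Y"
  shows "\<xi> \<in> concave_subgradients X (\<lambda>x'. f x' y) x"
    and "\<zeta> \<in> concave_subgradients Y (\<lambda>y'. f x y') y"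
proof -
  have *: "(- \<xi>, - \<zeta>) \<in> subgradients (X \<times> Y) (\<lambda>(x, y). - f x y) (x, y)"
    using assms(1) by (simp add: concave_subgradients_def case_prod_beta')
  show "\<xi> \<in> concave_subgradients X (\<lambda>x'. f x' y) x"
    and "\<zeta> \<in> concave_subgradients Y (\<lambda>y'. f x y') y"
    using subgradients_blocks[OF * assms(2,3)] by (simp_all add: concave_subgradients_def)
qed

definition saddle_point_on ::
  "('a \<times> 'b \<times> 'c \<times> 'd) set \<Rightarrow> ('a \<Rightarrow> 'b \<Rightarrow> 'c \<Rightarrow> 'd \<Rightarrow> real) \<Rightarrow> 'a \<Rightarrow> 'b \<Rightarrow> 'c \<Rightarrow> 'd \<Rightarrow> bool" where
  "saddle_point_on S \<phi> w' D' \<mu>' z' \<longleftrightarrow>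
     (w', D', \<mu>', z') \<in> S \<and>
     (\<forall>(w, D, \<mu>, z)\<in>S. \<phi> w' D' \<mu> z \<le> \<phi> w' D' \<mu>' z' \<and> \<phi> w' D' \<mu>' z' \<le> \<phi> w D \<mu>' z')"

text \<open>Note the index shift: \<open>time_avg x t\<close> is the running average \<open>x\<^sup>a\<^sup>v\<close> of index \<open>t + 1\<close>.\<close>

definition time_avg :: "(nat \<Rightarrow> 'a::real_vector) \<Rightarrow> nat \<Rightarrow> 'a" where
  "time_avg x t = (1 / real t) *\<^sub>R (\<Sum>s = 1..t. x s)"

text \<open>The bound \<open>u(t, w\<^sub>p, D\<^sub>p)\<close>; instantiated with the dual iterates and their subgradients
  it is \<open>u(t, \<mu>\<^sub>p, z\<^sub>p)\<close>.\<close>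

definition u_bound ::
  "real \<Rightarrow> real \<Rightarrow> (nat \<Rightarrow> real) \<Rightarrow>
   (nat \<Rightarrow> 'a::real_normed_vector) \<Rightarrow> (nat \<Rightarrow> 'b::real_normed_vector ^ 'n) \<Rightarrow>
   (nat \<Rightarrow> 'a) \<Rightarrow> (nat \<Rightarrow> 'b ^ 'n) \<Rightarrow> nat \<Rightarrow> 'a \<Rightarrow> 'b ^ 'n \<Rightarrow> real" where
  "u_bound \<sigma> \<Lambda> \<eta> w D gw gD t wp Dp =
     (\<Sum>s = 2..t. ((norm (w s - wp))\<^sup>2 + (norm (avg_op (D s) - Dp))\<^sup>2)
                   * (1 / \<eta> s - 1 / \<eta> (s - 1)))
     + 2 / \<eta> 1 * ((norm (w 1))\<^sup>2 + (norm wp)\<^sup>2 + (norm (D 1))\<^sup>2 + (norm Dp)\<^sup>2)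
     + 6 * (\<Sum>s = 1..t. \<eta> s * ((norm (gw s))\<^sup>2 + (norm (gD s))\<^sup>2))
     + 2 * (2 + \<sigma> * \<Lambda>) * (\<Sum>s = 1..t. norm (gD s) * norm (disagreement_op (D s)))
     + 2 * norm (disagreement_op Dp) * (\<Sum>s = 1..t. norm (gD s))"

end

theory Submission
  imports Defs
begin

text \<open>
  Since the digraphs are weight-balanced and \<open>\<sigma>\<close> is at most the inverse of every out-degree,
  \<open>I - \<sigma> L\<^sub>t\<close> is doubly stochastic. Hence \<open>q = D\<^sub>t - \<sigma> L\<^sub>t D\<^sub>t\<close> is feasible, has the same agent
  average as \<open>D\<^sub>t\<close>, and its disagreement is no larger. Feasibility makes the projection of
  \<open>q - \<eta>\<^sub>t g\<close> lie within \<open>\<eta>\<^sub>t \<parallel>g\<parallel>\<close> of \<open>q\<close>; subtracting the disagreement part from the usual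
  projected-subgradient estimate by Pythagoras therefore yields a one-step estimate for the
  agent averages. Dividing by \<open>\<eta>\<^sub>t\<close> and summing by parts bounds the accumulated first-order
  regret with respect to any comparison point by \<open>u\<close>. The saddle-point inequalities follow by
  applying this to the primal variables and, with \<open>- \<phi>\<close>, to the dual ones, choosing as comparison
  points the saddle point on one side and the time average on the other, and using Jensen's
  inequality.
\<close>

section \<open>Singular values and the operator norm\<close>

lemma inner_transpose_matrix_vector:
  fixes A :: "real ^ 'n ^ 'm"
  shows "(transpose A *v x) \<bullet> y = x \<bullet> (A *v y)"
  by (metis dot_lmul_matrix vector_transpose_matrix transpose_transpose)

text \<open>\<open>sigma_max\<close> is a \<open>Max\<close>, which is informative only on a finite
  set. Eigenvectors of the symmetric matrix \<open>transpose A ** A\<close> for distinct eigenvalues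
  are orthogonal, and a pairwise orthogonal family in finite dimension is finite.\<close>

lemma finite_singular_values:
  fixes A :: "real ^ 'n ^ 'm"
  shows "finite (singular_values A)"
proof -
  define B where "B = transpose A ** A"
  define e where "e s = (SOME v. v \<noteq> 0 \<and> B *v v = s\<^sup>2 *\<^sub>R v)" for s :: real
  have e: "e s \<noteq> 0" "B *v e s = s\<^sup>2 *\<^sub>R e s" if "s \<in> singular_values A" for s
  proof -
    have "\<exists>v. v \<noteq> 0 \<and> B *v v = s\<^sup>2 *\<^sub>R v"
      using that by (auto simp: singular_values_def B_def)
    then have "e s \<noteq> 0 \<and> B *v e s = s\<^sup>2 *\<^sub>R e s"
      unfolding e_def by (rule someI_ex)
    then show "e s \<noteq> 0" "B *v e s = s\<^sup>2 *\<^sub>R e s" by auto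
  qed
  have sym: "(B *v x) \<bullet> y = x \<bullet> (B *v y)" for x y
    by (metis B_def inner_transpose_matrix_vector matrix_vector_mul_assoc inner_commute)
  have orth: "e s \<bullet> e r = 0"
    if "s \<in> singular_values A" "r \<in> singular_values A" "s \<noteq> r" for s r
  proof -
    have "s\<^sup>2 * (e s \<bullet> e r) = r\<^sup>2 * (e s \<bullet> e r)"
      using sym[of "e s" "e r"] e that by simp
    moreover have "s\<^sup>2 \<noteq> r\<^sup>2"
      using that by (auto simp: singular_values_def)
    ultimately show ?thesis by simp
  qed
  have inj: "inj_on e (singular_values A)"
    by (rule inj_onI) (metis e(1) inner_eq_zero_iff orth)
  have "pairwise orthogonal (e ` singular_values A)"
    by (auto simp: pairwise_def orthogonal_def intro: orth)
  then have "finite (e ` singular_values A)"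
    by (rule pairwise_orthogonal_imp_finite)
  with inj show ?thesis
    by (simp add: finite_image_iff)
qed

text \<open>By compactness \<open>norm (A *v u)\<close> attains its maximum \<open>m\<close> over
  unit vectors at some \<open>v\<close>. First-order optimality makes \<open>v\<close> an
  eigenvector of \<open>transpose A ** A\<close> with eigenvalue \<open>m\<^sup>2\<close>, so the
  operator norm \<open>m\<close> is itself a singular value.\<close>

lemma norm_matrix_vector_le_sigma_max:
  fixes A :: "real ^ 'n ^ 'm"
  shows "norm (A *v x) \<le> sigma_max A * norm x" and "0 \<le> sigma_max A"
proof -
  have "\<exists>v\<in>sphere 0 1. \<forall>u\<in>sphere 0 1. norm (A *v u) \<le> norm (A *v v)"
    by (intro continuous_attains_sup continuous_intros) auto
  then obtain v where v: "norm v = 1" and max: "\<And>u. norm u = 1 \<Longrightarrow> norm (A *v u) \<le> norm (A *v v)"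
    by (auto simp: sphere_def)
  define m where "m = norm (A *v v)"
  have bound: "norm (A *v u) \<le> m * norm u" for u
  proof (cases "u = 0")
    case False
    then have "norm (A *v (u /\<^sub>R norm u)) \<le> m"
      unfolding m_def by (intro max) simp
    also have "A *v (u /\<^sub>R norm u) = (A *v u) /\<^sub>R norm u"
      by (simp add: matrix_vector_mult_scaleR)
    finally show ?thesis
      using False by (simp add: field_simps)
  qed simp
  \<comment> \<open>The form \<open>m\<^sup>2 \<parallel>u\<parallel>\<^sup>2 - \<parallel>A u\<parallel>\<^sup>2\<close> is nonnegative and vanishes at \<open>v\<close>, so its gradient \<open>2 r\<close>
    vanishes there.\<close>
  define r where "r = m\<^sup>2 *\<^sub>R v - (transpose A ** A) *v v"
  define c where "c = m\<^sup>2 * (r \<bullet> r) - (A *v r) \<bullet> (A *v r)"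
  have form: "(A *v u) \<bullet> (A *v u) \<le> m\<^sup>2 * (u \<bullet> u)" for u
    using power_mono[OF bound[of u], of 2]
    by (simp add: power_mult_distrib power2_norm_eq_inner)
  have quad: "0 \<le> 2 * k * (r \<bullet> r) + k\<^sup>2 * c" for k
  proof -
    have AAv: "((transpose A ** A) *v v) \<bullet> r = (A *v v) \<bullet> (A *v r)"
      by (metis inner_transpose_matrix_vector matrix_vector_mul_assoc)
    have mm: "(A *v v) \<bullet> (A *v v) = m\<^sup>2" "v \<bullet> v = 1"
      using v by (simp_all add: m_def power2_norm_eq_inner flip: norm_eq_1)
    have rr: "m\<^sup>2 * (v \<bullet> r) - (A *v v) \<bullet> (A *v r) = r \<bullet> r"
      using AAv by (subst (3) r_def) (simp add: inner_diff_left)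
    have exp_v: "(v + k *\<^sub>R r) \<bullet> (v + k *\<^sub>R r) = 1 + 2 * k * (v \<bullet> r) + k\<^sup>2 * (r \<bullet> r)"
      using mm by (simp add: inner_add_left inner_add_right inner_commute power2_eq_square)
    have exp_Av: "(A *v (v + k *\<^sub>R r)) \<bullet> (A *v (v + k *\<^sub>R r))
        = m\<^sup>2 + 2 * k * ((A *v v) \<bullet> (A *v r)) + k\<^sup>2 * ((A *v r) \<bullet> (A *v r))"
      using mm by (simp add: matrix_vector_right_distrib matrix_vector_mult_scaleR inner_add_left
          inner_add_right inner_commute power2_eq_square)
    have "0 \<le> m\<^sup>2 * (1 + 2 * k * (v \<bullet> r) + k\<^sup>2 * (r \<bullet> r))
        - (m\<^sup>2 + 2 * k * ((A *v v) \<bullet> (A *v r)) + k\<^sup>2 * ((A *v r) \<bullet> (A *v r)))"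
      using form[of "v + k *\<^sub>R r"] unfolding exp_v exp_Av by simp
    also have "\<dots> = 2 * k * (m\<^sup>2 * (v \<bullet> r) - (A *v v) \<bullet> (A *v r)) + k\<^sup>2 * c"
      unfolding c_def by algebra
    finally show ?thesis
      unfolding rr .
  qed
  have "r \<bullet> r = 0"
  proof (rule ccontr)
    assume "r \<bullet> r \<noteq> 0"
    then have a: "r \<bullet> r > 0" by simp
    have c: "c \<ge> 0" using form[of r] by (simp add: c_def)
    \<comment> \<open>Moving from \<open>v\<close> by \<open>k = - e * (r \<bullet> r)\<close> turns
      the quadratic of \<open>quad\<close> into
      \<open>e * (r \<bullet> r)\<^sup>2 * (e * c - 2)\<close>. Any positive \<open>e\<close> with
      \<open>e * c < 2\<close> makes this negative; \<open>1 / (c + 1)\<close> also covers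
      \<open>c = 0\<close>.\<close>
    define e where "e = 1 / (c + 1)"
    have e: "e > 0" "e * c < 1"
      using c by (simp_all add: e_def)
    have "0 \<le> 2 * (- e * (r \<bullet> r)) * (r \<bullet> r) + (- e * (r \<bullet> r))\<^sup>2 * c"
      by (rule quad)
    also have "\<dots> = (e * (r \<bullet> r)\<^sup>2) * (e * c - 2)"
      by algebra
    also have "\<dots> < 0"
      using a e by (intro mult_pos_neg) auto
    finally show False by simp
  qed
  then have "(transpose A ** A) *v v = m\<^sup>2 *\<^sub>R v"
    by (simp add: r_def)
  then have "m \<in> singular_values A"
    using v unfolding singular_values_def m_def by (auto intro!: exI[of _ v])
  then have m_le: "m \<le> sigma_max A"
    unfolding sigma_max_def using finite_singular_values by (rule Max_ge[rotated])
  show "norm (A *v x) \<le> sigma_max A * norm x"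
    using bound[of x] mult_right_mono[OF m_le norm_ge_zero[of x]] by linarith
  show "0 \<le> sigma_max A"
    using m_le by (simp add: m_def order_trans[OF norm_ge_zero])
qed

section \<open>The Kronecker action and doubly stochastic matrices\<close>

lemma kron_id_nth: "kron_id B X $ i = (\<Sum>j\<in>UNIV. B $ i $ j *\<^sub>R X $ j)"
  by (simp add: kron_id_def)

lemma kron_id_diff_right: "kron_id B (X - Y) = kron_id B X - kron_id B Y"
  by (simp add: vec_eq_iff kron_id_nth scaleR_diff_right sum_subtractf)

lemma kron_id_diff_left: "kron_id (B - C) X = kron_id B X - kron_id C X"
  by (simp add: vec_eq_iff kron_id_nth scaleR_diff_left sum_subtractf)

lemma kron_id_scaleR_left: "kron_id (c *\<^sub>R B) X = c *\<^sub>R kron_id B X"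
  by (simp add: vec_eq_iff kron_id_nth scaleR_sum_right)

lemma kron_id_mat_1: "kron_id (mat 1) X = X"
  by (simp add: vec_eq_iff kron_id_nth mat_def if_distrib[of "\<lambda>c. c *\<^sub>R _"] cong: if_cong)

text \<open>For each basis vector \<open>b\<close> of the block space, the scalar vector of
  \<open>b\<close>-coordinates is multiplied by \<open>B\<close> alone. The squared matrix-vector
  bounds add up over \<open>b\<close>.\<close>

lemma norm_kron_id_le_sigma_max:
  fixes X :: "'a::euclidean_space ^ 'n"
  shows "norm (kron_id B X) \<le> sigma_max B * norm X"
proof -
  define Xb where "Xb b = (\<chi> i. X $ i \<bullet> b)" for b
  have sq: "(norm Y)\<^sup>2 = (\<Sum>b\<in>Basis. (norm (\<chi> i. Y $ i \<bullet> b))\<^sup>2)" for Y :: "'a ^ 'n"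
  proof -
    have "(norm Y)\<^sup>2 = (\<Sum>i\<in>UNIV. \<Sum>b\<in>Basis. (Y $ i \<bullet> b) * (Y $ i \<bullet> b))"
      by (simp add: power2_norm_eq_inner inner_vec_def euclidean_inner[symmetric])
    also have "\<dots> = (\<Sum>b\<in>Basis. \<Sum>i\<in>UNIV. (Y $ i \<bullet> b) * (Y $ i \<bullet> b))"
      by (rule sum.swap)
    finally show ?thesis
      by (simp add: power2_norm_eq_inner inner_vec_def)
  qed
  have coord: "(\<chi> i. kron_id B X $ i \<bullet> b) = B *v Xb b" for b
    by (simp add: vec_eq_iff kron_id_nth Xb_def matrix_vector_mult_def inner_sum_left)
  have "(norm (kron_id B X))\<^sup>2 = (\<Sum>b\<in>Basis. (norm (B *v Xb b))\<^sup>2)"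
    by (simp add: sq[of "kron_id B X"] coord)
  also have "\<dots> \<le> (\<Sum>b\<in>Basis. (sigma_max B * norm (Xb b))\<^sup>2)"
    by (intro sum_mono power_mono norm_matrix_vector_le_sigma_max) simp
  also have "\<dots> = (sigma_max B * norm X)\<^sup>2"
    by (simp add: power_mult_distrib sq[of X] Xb_def sum_distrib_left)
  finally show ?thesis
    by (rule power2_le_imp_le) (simp add: norm_matrix_vector_le_sigma_max)
qed

definition doubly_stochastic :: "real ^ 'n ^ 'n \<Rightarrow> bool" where
  "doubly_stochastic B \<longleftrightarrow> (\<forall>i j. 0 \<le> B $ i $ j) \<and>
     (\<forall>i. (\<Sum>j\<in>UNIV. B $ i $ j) = 1) \<and> (\<forall>j. (\<Sum>i\<in>UNIV. B $ i $ j) = 1)"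

lemma doubly_stochastic_averaging_matrix: "doubly_stochastic averaging_matrix"
  by (simp add: doubly_stochastic_def averaging_matrix_def)

text \<open>With \<open>Y = kron_id B X\<close>, expand the squared norm of \<open>Y\<close> as an
  inner product of \<open>Y\<close> with \<open>kron_id B X\<close> and bound each
  \<open>X $ j \<bullet> Y $ i\<close> by half the sum of squares. Column sums collect the
  \<open>X\<close> terms and row sums the \<open>Y\<close> terms, and half the squared norm of
  \<open>Y\<close> is absorbed on the left.\<close>

lemma norm_kron_id_doubly_stochastic_le:
  fixes X :: "'a::real_inner ^ 'n"
  assumes "doubly_stochastic B"
  shows "norm (kron_id B X) \<le> norm X"
proof -
  define Y where "Y = kron_id B X"
  have B: "0 \<le> B $ i $ j" "(\<Sum>j\<in>UNIV. B $ i $ j) = 1" "(\<Sum>i\<in>UNIV. B $ i $ j) = 1" for i j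
    using assms by (auto simp: doubly_stochastic_def)
  have sq: "(norm Z)\<^sup>2 = (\<Sum>i\<in>UNIV. (norm (Z $ i))\<^sup>2)" for Z :: "'a ^ 'n"
    by (simp add: power2_norm_eq_inner inner_vec_def)
  have "(norm Y)\<^sup>2 = (\<Sum>i\<in>UNIV. \<Sum>j\<in>UNIV. B $ i $ j * (X $ j \<bullet> Y $ i))"
    unfolding power2_norm_eq_inner inner_vec_def
    by (subst (1) Y_def) (simp add: kron_id_nth inner_sum_left)
  also have "\<dots> \<le> (\<Sum>i\<in>UNIV. \<Sum>j\<in>UNIV. B $ i $ j * (((norm (X $ j))\<^sup>2 + (norm (Y $ i))\<^sup>2) / 2))"
  proof (intro sum_mono mult_left_mono B)
    fix i j
    have "0 \<le> (X $ j - Y $ i) \<bullet> (X $ j - Y $ i)" by simp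
    then show "X $ j \<bullet> Y $ i \<le> ((norm (X $ j))\<^sup>2 + (norm (Y $ i))\<^sup>2) / 2"
      by (simp add: power2_norm_eq_inner inner_diff_left inner_diff_right inner_commute)
  qed
  also have "\<dots> = ((\<Sum>i\<in>UNIV. \<Sum>j\<in>UNIV. B $ i $ j * (norm (X $ j))\<^sup>2)
      + (\<Sum>i\<in>UNIV. \<Sum>j\<in>UNIV. B $ i $ j * (norm (Y $ i))\<^sup>2)) / 2"
    by (simp add: distrib_left add_divide_distrib sum.distrib sum_divide_distrib)
  also have "(\<Sum>i\<in>UNIV. \<Sum>j\<in>UNIV. B $ i $ j * (norm (X $ j))\<^sup>2) = (norm X)\<^sup>2"
    by (subst sum.swap) (simp add: B sq flip: sum_distrib_right)
  also have "(\<Sum>i\<in>UNIV. \<Sum>j\<in>UNIV. B $ i $ j * (norm (Y $ i))\<^sup>2) = (norm Y)\<^sup>2"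
    by (simp add: B sq flip: sum_distrib_right)
  finally have "(norm Y)\<^sup>2 \<le> (norm X)\<^sup>2" by simp
  then show ?thesis
    unfolding Y_def by (rule power2_le_imp_le) simp
qed

lemma kron_id_doubly_stochastic_in_agent_product:
  assumes "doubly_stochastic B" and "convex C" and "X \<in> agent_product C"
  shows "kron_id B X \<in> agent_product C"
  using assms by (auto simp: doubly_stochastic_def agent_product_def kron_id_nth intro!: convex_sum)

section \<open>Agent averages, disagreement and the perturbed averaging step\<close>

lemma avg_op_nth: "avg_op X $ i = (1 / real CARD('n)) *\<^sub>R (\<Sum>j\<in>UNIV. X $ j)"
  for X :: "'a::real_vector ^ 'n"
  by (simp add: avg_op_def averaging_matrix_def kron_id_nth scaleR_sum_right)

lemma avg_op_diff: "avg_op (X - Y) = avg_op X - avg_op Y"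
  by (simp add: avg_op_def kron_id_diff_right)

lemma disagreement_op_eq: "disagreement_op X = X - avg_op X"
  by (simp add: disagreement_op_def avg_op_def kron_id_diff_left kron_id_mat_1)

lemma avg_op_kron_id:
  assumes "doubly_stochastic B"
  shows "avg_op (kron_id B X) = avg_op X"
proof -
  have "(\<Sum>i\<in>UNIV. kron_id B X $ i) = (\<Sum>j\<in>UNIV. (\<Sum>i\<in>UNIV. B $ i $ j) *\<^sub>R X $ j)"
    unfolding kron_id_nth scaleR_sum_left by (rule sum.swap)
  then show ?thesis
    using assms by (simp add: vec_eq_iff avg_op_nth doubly_stochastic_def)
qed

text \<open>All blocks of \<open>avg_op X\<close> coincide, so a matrix acts on it through its row
  sums. The cases of interest are \<open>c = 1\<close> for doubly stochastic matrices and
  \<open>c = 0\<close> for Laplacians.\<close>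

lemma kron_id_avg_op:
  assumes "\<And>i. (\<Sum>j\<in>UNIV. B $ i $ j) = c"
  shows "kron_id B (avg_op X) = c *\<^sub>R avg_op X"
proof -
  have "kron_id B (avg_op X) $ i = c *\<^sub>R avg_op X $ i" for i
  proof -
    have "kron_id B (avg_op X) $ i = (\<Sum>j\<in>UNIV. B $ i $ j *\<^sub>R avg_op X $ i)"
      by (simp add: kron_id_nth avg_op_nth)
    then show ?thesis
      using assms by (simp flip: scaleR_sum_left)
  qed
  then show ?thesis by (simp add: vec_eq_iff)
qed

lemma avg_op_idem: "avg_op (avg_op X) = avg_op X"
  using avg_op_kron_id[OF doubly_stochastic_averaging_matrix, of X] by (simp add: avg_op_def)

text \<open>One factor has equal blocks, the blocks of the other sum to zero.\<close>

lemma inner_avg_op_disagreement_op: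
  fixes X Y :: "'a::real_inner ^ 'n"
  shows "avg_op X \<bullet> disagreement_op Y = 0"
proof -
  have "(\<Sum>i\<in>UNIV. disagreement_op Y $ i) = 0"
    by (simp add: disagreement_op_eq sum_subtractf avg_op_nth sum_constant_scaleR)
  then have "m \<bullet> (\<Sum>i\<in>UNIV. disagreement_op Y $ i) = 0" for m
    by simp
  then show ?thesis
    unfolding inner_vec_def avg_op_nth inner_sum_right .
qed

lemma norm_avg_op_le: "norm (avg_op X) \<le> norm X" for X :: "'a::real_inner ^ 'n"
  unfolding avg_op_def
  by (rule norm_kron_id_doubly_stochastic_le[OF doubly_stochastic_averaging_matrix])

lemma norm_avg_op_disagreement_op:
  fixes X :: "'a::real_inner ^ 'n"
  shows "(norm X)\<^sup>2 = (norm (avg_op X))\<^sup>2 + (norm (disagreement_op X))\<^sup>2"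
proof -
  have "X = avg_op X + disagreement_op X" by (simp add: disagreement_op_eq)
  then have "(norm X)\<^sup>2 = (norm (avg_op X + disagreement_op X))\<^sup>2" by simp
  also have "\<dots> = (norm (avg_op X))\<^sup>2 + (norm (disagreement_op X))\<^sup>2"
    using inner_avg_op_disagreement_op[of X X]
    by (simp add: power2_norm_eq_inner inner_add_left inner_add_right inner_commute)
  finally show ?thesis .
qed

lemma disagreement_op_diff: "disagreement_op (X - Y) = disagreement_op X - disagreement_op Y"
  by (simp add: disagreement_op_eq avg_op_diff)

lemma disagreement_op_avg_op: "disagreement_op (avg_op X) = 0"
  by (simp add: disagreement_op_eq avg_op_idem)

lemma norm_disagreement_op_le: "norm (disagreement_op X) \<le> norm X" for X :: "'a::real_inner ^ 'n"
  by (rule power2_le_imp_le) (simp_all add: norm_avg_op_disagreement_op[of X])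

lemma disagreement_op_kron_id:
  assumes "doubly_stochastic B"
  shows "disagreement_op (kron_id B X) = kron_id B (disagreement_op X)"
  using assms kron_id_avg_op[of B 1 X]
  by (simp add: disagreement_op_eq kron_id_diff_right avg_op_kron_id doubly_stochastic_def)

text \<open>\<open>Y\<close> plays the projection of \<open>kron_id B X - H\<close>, characterised
  by its variational inequality. One \<open>(norm H)\<^sup>2\<close> comes from the projection
  estimate; the other, together with the term in \<open>disagreement_op X\<close>, bounds how much
  disagreement the projection can remove. The term in \<open>disagreement_op P\<close> pays for
  replacing \<open>P\<close> by its average.\<close>

lemma perturbed_averaging_step:
  fixes X Y H P :: "'a::real_inner ^ 'n"
  assumes B: "doubly_stochastic B" and "convex C"
    and X: "X \<in> agent_product C" and P: "P \<in> agent_product C"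
    and proj: "\<And>V. V \<in> agent_product C \<Longrightarrow> (kron_id B X - H - Y) \<bullet> (V - Y) \<le> 0"
  shows "(norm (avg_op Y - P))\<^sup>2 \<le> (norm (avg_op X - P))\<^sup>2 - 2 * (H \<bullet> (kron_id B X - P))
    + 2 * (norm H)\<^sup>2 + 2 * norm H * norm (disagreement_op X) + 2 * norm H * norm (disagreement_op P)"
proof -
  define Q where "Q = kron_id B X"
  \<comment> \<open>Testing against the consensus point \<open>R\<close> rather than
    \<open>P\<close> makes the disagreement of \<open>V - R\<close> equal to that of
    \<open>V\<close>, so Pythagoras separates the averages cleanly.\<close>
  define R where "R = avg_op P"
  have Q: "Q \<in> agent_product C"
    unfolding Q_def using assms by (intro kron_id_doubly_stochastic_in_agent_product)
  have R: "R \<in> agent_product C"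
    unfolding R_def avg_op_def using assms doubly_stochastic_averaging_matrix
    by (intro kron_id_doubly_stochastic_in_agent_product)
  \<comment> \<open>Since \<open>Q\<close> is feasible, it is itself a test point: the inequality at
    \<open>Q\<close> reads \<open>(norm (Q - Y))\<^sup>2 \<le> H \<bullet> (Q - Y)\<close>.\<close>
  have near: "norm (Q - Y) \<le> norm H"
  proof -
    have "norm (Q - Y) * norm (Q - Y) \<le> H \<bullet> (Q - Y)"
      using proj[OF Q]
      by (simp add: Q_def[symmetric] inner_diff_left power2_norm_eq_inner flip: power2_eq_square)
    also have "\<dots> \<le> norm H * norm (Q - Y)"
      by (rule norm_cauchy_schwarz)
    finally show ?thesis
      by (cases "Q = Y") auto
  qed
  have "(Q - H - Y) \<bullet> (R - Y) \<le> 0"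
    using proj[OF R] by (simp add: Q_def)
  moreover have "(norm (Y - R))\<^sup>2 = (norm (Q - H - R))\<^sup>2 - (norm (Q - H - Y))\<^sup>2
      + 2 * ((Q - H - Y) \<bullet> (R - Y))"
    by (simp add: power2_norm_eq_inner algebra_simps inner_commute)
  moreover have "(norm (Q - H - R))\<^sup>2 = (norm (Q - R))\<^sup>2 - 2 * (H \<bullet> (Q - R)) + (norm H)\<^sup>2"
    by (simp add: power2_norm_eq_inner algebra_simps inner_commute)
  moreover have "0 \<le> (norm (Q - H - Y))\<^sup>2" by simp
  ultimately have proj_R:
    "(norm (Y - R))\<^sup>2 \<le> (norm (Q - R))\<^sup>2 - 2 * (H \<bullet> (Q - R)) + (norm H)\<^sup>2"
    by linarith
  have pyth: "(norm (V - R))\<^sup>2 = (norm (avg_op V - R))\<^sup>2 + (norm (disagreement_op V))\<^sup>2"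
    for V :: "'a ^ 'n"
    using norm_avg_op_disagreement_op[of "V - R"]
    by (simp add: R_def avg_op_diff avg_op_idem disagreement_op_diff disagreement_op_avg_op)
  have pyth_P: "(norm (avg_op V - P))\<^sup>2 = (norm (avg_op V - R))\<^sup>2 + (norm (disagreement_op P))\<^sup>2"
    for V :: "'a ^ 'n"
    using norm_avg_op_disagreement_op[of "avg_op V - P"]
    by (simp add: R_def avg_op_diff avg_op_idem disagreement_op_diff disagreement_op_avg_op)
  have avgQ: "avg_op Q = avg_op X"
    unfolding Q_def using B by (rule avg_op_kron_id)
  have disQ: "norm (disagreement_op Q) \<le> norm (disagreement_op X)"
    unfolding Q_def using B
    by (simp add: disagreement_op_kron_id norm_kron_id_doubly_stochastic_le)
  \<comment> \<open>Factor the difference of squares: the first factor is at most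
    \<open>norm H\<close>, and the second at most
    \<open>2 * norm (disagreement_op X) + norm H\<close>, because \<open>Q\<close> disagrees no more
    than \<open>X\<close>.\<close>
  have dis: "(norm (disagreement_op Q))\<^sup>2 - (norm (disagreement_op Y))\<^sup>2
      \<le> 2 * norm H * norm (disagreement_op X) + (norm H)\<^sup>2"
  proof -
    have "norm (disagreement_op Q - disagreement_op Y) \<le> norm H"
      using norm_disagreement_op_le[of "Q - Y"] near by (simp add: disagreement_op_diff)
    then have *: "\<bar>norm (disagreement_op Q) - norm (disagreement_op Y)\<bar> \<le> norm H"
      using norm_triangle_ineq3 order_trans by blast
    have "(norm (disagreement_op Q))\<^sup>2 - (norm (disagreement_op Y))\<^sup>2
        = (norm (disagreement_op Q) - norm (disagreement_op Y))
          * (norm (disagreement_op Q) + norm (disagreement_op Y))"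
      by (simp add: algebra_simps power2_eq_square)
    also have "\<dots> \<le> norm H * (norm (disagreement_op Q) + norm (disagreement_op Y))"
      using * by (intro mult_right_mono) auto
    also have "\<dots> \<le> norm H * (2 * norm (disagreement_op X) + norm H)"
      using * disQ by (intro mult_left_mono) auto
    finally show ?thesis
      by (simp add: algebra_simps power2_eq_square)
  qed
  have "H \<bullet> (Q - P) = H \<bullet> (Q - R) - H \<bullet> disagreement_op P"
    by (simp add: R_def disagreement_op_eq algebra_simps)
  moreover have "- (H \<bullet> disagreement_op P) \<le> norm H * norm (disagreement_op P)"
    using Cauchy_Schwarz_ineq2[of H "disagreement_op P"] by linarith
  ultimately have "H \<bullet> (Q - P) \<le> H \<bullet> (Q - R) + norm H * norm (disagreement_op P)"
    by linarith
  then show ?thesis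
    using proj_R pyth[of Y] pyth[of Q] pyth_P[of X] pyth_P[of Y] dis unfolding avgQ
    by (simp add: Q_def)
qed

section \<open>Laplacians of weight-balanced digraphs and single steps of the dynamics\<close>

lemma laplacian_nth:
  "laplacian A $ i $ j = (if i = j then out_degree A i else 0) - A $ i $ j"
  by (simp add: laplacian_def out_degree_def matrix_vector_mult_def)

lemma sum_laplacian_row: "(\<Sum>j\<in>UNIV. laplacian A $ i $ j) = 0"
  by (simp add: laplacian_nth sum_subtractf out_degree_def)

lemma sum_laplacian_column:
  assumes "weight_balanced A"
  shows "(\<Sum>i\<in>UNIV. laplacian A $ i $ j) = 0"
  using assms by (simp add: laplacian_nth sum_subtractf out_degree_def weight_balanced_def)

lemma doubly_stochastic_laplacian_step:
  assumes "\<And>i j. 0 \<le> A $ i $ j" and "weight_balanced A" and "0 \<le> \<sigma>"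
    and "\<And>i. \<sigma> * out_degree A i \<le> 1"
  shows "doubly_stochastic (mat 1 - \<sigma> *\<^sub>R laplacian A)"
proof -
  have "0 \<le> (mat 1 - \<sigma> *\<^sub>R laplacian A) $ i $ j" for i j
  proof -
    have "0 \<le> \<sigma> * A $ i $ j"
      using assms by simp
    then show ?thesis
      \<comment> \<open>Off the diagonal the entry is \<open>\<sigma> * A $ i $ j\<close>; on it,
        \<open>1 - \<sigma> * out_degree A i + \<sigma> * A $ i $ i\<close>.\<close>
      using assms(4)[of i] by (cases "i = j") (simp_all add: laplacian_nth mat_def algebra_simps)
  qed
  then show ?thesis
    using assms(2)
    by (simp add: doubly_stochastic_def sum_subtractf mat_def sum_laplacian_row
        sum_laplacian_column flip: sum_distrib_left)
qed

text \<open>The rows of the Laplacian sum to zero, so it annihilates the average and sees only the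
  disagreement.\<close>

lemma norm_kron_id_laplacian_le:
  fixes X :: "'a::euclidean_space ^ 'n"
  shows "norm (kron_id (laplacian A) X) \<le> sigma_max (laplacian A) * norm (disagreement_op X)"
proof -
  have "kron_id (laplacian A) X = kron_id (laplacian A) (disagreement_op X)"
    using kron_id_avg_op[of "laplacian A" 0 X]
    by (simp add: disagreement_op_eq kron_id_diff_right sum_laplacian_row)
  then show ?thesis
    by (simp add: norm_kron_id_le_sigma_max)
qed

text \<open>This is the perturbed averaging step with matrix
  \<open>mat 1 - \<sigma> *\<^sub>R laplacian A\<close> and \<open>H = \<eta> *\<^sub>R G\<close>,
  divided by \<open>\<eta>\<close>. Evaluating the inner product at \<open>X\<close> instead of the
  averaged point costs \<open>\<sigma> * (G \<bullet> L)\<close>, whence the factor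
  \<open>\<sigma> * \<Lambda>\<close>.\<close>

lemma projected_consensus_step:
  fixes X Y G P :: "'a::euclidean_space ^ 'n"
  assumes ds: "doubly_stochastic (mat 1 - \<sigma> *\<^sub>R laplacian A)" and "convex C"
    and \<Lambda>: "sigma_max (laplacian A) \<le> \<Lambda>" and "0 < \<sigma>" and "0 < \<eta>"
    and X: "X \<in> agent_product C" and P: "P \<in> agent_product C"
    and proj: "\<And>V. V \<in> agent_product C \<Longrightarrow>
      (X - \<sigma> *\<^sub>R kron_id (laplacian A) X - \<eta> *\<^sub>R G - Y) \<bullet> (V - Y) \<le> 0"
  shows "2 * (G \<bullet> (X - P)) \<le> ((norm (avg_op X - P))\<^sup>2 - (norm (avg_op Y - P))\<^sup>2) / \<eta>
    + 6 * \<eta> * (norm G)\<^sup>2 + 2 * (2 + \<sigma> * \<Lambda>) * (norm G * norm (disagreement_op X))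
    + 2 * norm (disagreement_op P) * norm G"
proof -
  define L where "L = kron_id (laplacian A) X"
  have step: "kron_id (mat 1 - \<sigma> *\<^sub>R laplacian A) X = X - \<sigma> *\<^sub>R L"
    by (simp add: kron_id_diff_left kron_id_mat_1 kron_id_scaleR_left L_def)
  have "(norm (avg_op Y - P))\<^sup>2 \<le> (norm (avg_op X - P))\<^sup>2 - 2 * ((\<eta> *\<^sub>R G) \<bullet> (X - \<sigma> *\<^sub>R L - P))
      + 2 * (norm (\<eta> *\<^sub>R G))\<^sup>2 + 2 * norm (\<eta> *\<^sub>R G) * norm (disagreement_op X)
      + 2 * norm (\<eta> *\<^sub>R G) * norm (disagreement_op P)"
    unfolding step[symmetric] using assms
    by (intro perturbed_averaging_step) (simp_all add: step L_def)
  then have "2 * \<eta> * (G \<bullet> (X - P)) \<le> (norm (avg_op X - P))\<^sup>2 - (norm (avg_op Y - P))\<^sup>2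
      + \<eta> * (2 * \<sigma> * (G \<bullet> L) + 2 * \<eta> * (norm G)\<^sup>2 + 2 * norm G * norm (disagreement_op X)
        + 2 * norm G * norm (disagreement_op P))"
    using \<open>0 < \<eta>\<close> by (simp add: power_mult_distrib power2_eq_square algebra_simps)
  then have "2 * (G \<bullet> (X - P)) \<le> ((norm (avg_op X - P))\<^sup>2 - (norm (avg_op Y - P))\<^sup>2) / \<eta>
      + (2 * (\<sigma> * (G \<bullet> L)) + 2 * (\<eta> * (norm G)\<^sup>2) + 2 * (norm G * norm (disagreement_op X))
        + 2 * norm (disagreement_op P) * norm G)"
    using \<open>0 < \<eta>\<close> by (simp add: field_simps)
  moreover have "\<sigma> * (G \<bullet> L) \<le> \<sigma> * \<Lambda> * (norm G * norm (disagreement_op X))"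
  proof -
    have "norm L \<le> \<Lambda> * norm (disagreement_op X)"
      unfolding L_def
      using norm_kron_id_laplacian_le[of A X] mult_right_mono[OF \<Lambda> norm_ge_zero[of "disagreement_op X"]]
      by linarith
    then have "norm G * norm L \<le> norm G * (\<Lambda> * norm (disagreement_op X))"
      by (intro mult_left_mono) auto
    then have "G \<bullet> L \<le> \<Lambda> * (norm G * norm (disagreement_op X))"
      using norm_cauchy_schwarz[of G L] by (simp add: algebra_simps)
    then show ?thesis
      using \<open>0 < \<sigma>\<close> by (simp add: mult.assoc)
  qed
  \<comment> \<open>The argument yields the coefficients \<open>2\<close> and
    \<open>2 * (1 + \<sigma> * \<Lambda>)\<close>; these signs allow relaxing them to the
    \<open>6\<close> and \<open>2 * (2 + \<sigma> * \<Lambda>)\<close> of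
    \<open>u_bound\<close>.\<close>
  moreover have "0 \<le> \<eta> * (norm G)\<^sup>2" "0 \<le> norm G * norm (disagreement_op X)"
    using \<open>0 < \<eta>\<close> by auto
  moreover have "2 * (2 + \<sigma> * \<Lambda>) * (norm G * norm (disagreement_op X))
      = 4 * (norm G * norm (disagreement_op X)) + 2 * (\<sigma> * \<Lambda> * (norm G * norm (disagreement_op X)))"
    by algebra
  ultimately show ?thesis
    unfolding mult.assoc[of 6] by linarith
qed

text \<open>The classical projected-subgradient estimate, with the coefficient of
  \<open>\<eta> * (norm g)\<^sup>2\<close> raised from 1 to 6 to match the consensus block.\<close>

lemma projected_step:
  fixes x y g p :: "'a::real_inner"
  assumes "0 < \<eta>" and proj: "(x - \<eta> *\<^sub>R g - y) \<bullet> (p - y) \<le> 0"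
  shows "2 * (g \<bullet> (x - p)) \<le> ((norm (x - p))\<^sup>2 - (norm (y - p))\<^sup>2) / \<eta> + 6 * \<eta> * (norm g)\<^sup>2"
proof -
  have "(norm (y - p))\<^sup>2 = (norm (x - p))\<^sup>2 - 2 * \<eta> * (g \<bullet> (x - p)) + \<eta>\<^sup>2 * (norm g)\<^sup>2
      - (norm (x - \<eta> *\<^sub>R g - y))\<^sup>2 + 2 * ((x - \<eta> *\<^sub>R g - y) \<bullet> (p - y))"
    unfolding power2_norm_eq_inner by (simp add: power2_eq_square algebra_simps inner_commute)
  then have "2 * \<eta> * (g \<bullet> (x - p)) \<le> (norm (x - p))\<^sup>2 - (norm (y - p))\<^sup>2 + \<eta>\<^sup>2 * (norm g)\<^sup>2"
    using proj zero_le_power2[of "norm (x - \<eta> *\<^sub>R g - y)"] by linarith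
  then have "2 * (g \<bullet> (x - p)) \<le> ((norm (x - p))\<^sup>2 - (norm (y - p))\<^sup>2) / \<eta> + \<eta> * (norm g)\<^sup>2"
    using \<open>0 < \<eta>\<close> by (simp add: field_simps power2_eq_square)
  moreover have "0 \<le> \<eta> * (norm g)\<^sup>2"
    using \<open>0 < \<eta>\<close> by simp
  ultimately show ?thesis by linarith
qed

section \<open>Summation by parts and accumulated regret\<close>

lemma sum_divide_telescope_le:
  fixes a \<eta> :: "nat \<Rightarrow> real"
  assumes "1 \<le> t" and "\<And>s. 0 \<le> a s" and "\<And>s. 1 \<le> s \<Longrightarrow> 0 < \<eta> s"
  shows "(\<Sum>s = 1..t. (a s - a (s + 1)) / \<eta> s)
    \<le> a 1 / \<eta> 1 + (\<Sum>s = 2..t. a s * (1 / \<eta> s - 1 / \<eta> (s - 1)))"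
proof -
  \<comment> \<open>The induction needs the exact identity with its boundary term, which is
    discarded by sign only afterwards.\<close>
  have "(\<Sum>s = 1..t. (a s - a (s + 1)) / \<eta> s)
      = a 1 / \<eta> 1 + (\<Sum>s = 2..t. a s * (1 / \<eta> s - 1 / \<eta> (s - 1))) - a (t + 1) / \<eta> t"
    using \<open>1 \<le> t\<close>
  proof (induction t rule: dec_induct)
    case base
    then show ?case by (simp add: diff_divide_distrib)
  next
    case (step t)
    then show ?case by (simp add: algebra_simps diff_divide_distrib)
  qed
  moreover have "0 \<le> a (t + 1) / \<eta> t"
    using assms by (simp add: less_imp_le)
  ultimately show ?thesis by linarith
qed

lemma norm_diff_sq_le: "(norm (x - y))\<^sup>2 \<le> 2 * ((norm x)\<^sup>2 + (norm y)\<^sup>2)" for x :: "'a::real_inner"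
proof -
  have "(norm (x - y))\<^sup>2 + (norm (x + y))\<^sup>2 = 2 * ((norm x)\<^sup>2 + (norm y)\<^sup>2)"
    by (simp add: power2_norm_eq_inner algebra_simps inner_commute)
  then show ?thesis
    using zero_le_power2[of "norm (x + y)"] by linarith
qed

text \<open>Here \<open>gw\<close> and \<open>gD\<close> are arbitrary directions; convexity of an
  objective enters only in \<open>regret_le_u_bound\<close>. The \<open>w\<close> block takes a
  plain projected step, the \<open>D\<close> block a consensus step, and their distances are
  combined before summing by parts.\<close>

lemma first_order_regret_le_u_bound:
  fixes w gw :: "nat \<Rightarrow> 'a::real_inner" and D gD :: "nat \<Rightarrow> 'b::euclidean_space ^ 'n"
  assumes "1 \<le> t" and "convex C" and "0 < \<sigma>"
    and \<eta>: "\<And>s. 1 \<le> s \<Longrightarrow> 0 < \<eta> s"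
    and ds: "\<And>s. 1 \<le> s \<Longrightarrow> doubly_stochastic (mat 1 - \<sigma> *\<^sub>R laplacian (A s))"
    and \<Lambda>: "\<And>s. 1 \<le> s \<Longrightarrow> sigma_max (laplacian (A s)) \<le> \<Lambda>"
    and D: "\<And>s. 1 \<le> s \<Longrightarrow> D s \<in> agent_product C"
    and p: "wp \<in> W" "Dp \<in> agent_product C"
    and proj_w: "\<And>s v. 1 \<le> s \<Longrightarrow> v \<in> W \<Longrightarrow>
      (w s - \<eta> s *\<^sub>R gw s - w (s + 1)) \<bullet> (v - w (s + 1)) \<le> 0"
    and proj_D: "\<And>s V. 1 \<le> s \<Longrightarrow> V \<in> agent_product C \<Longrightarrow>
      (D s - \<sigma> *\<^sub>R kron_id (laplacian (A s)) (D s) - \<eta> s *\<^sub>R gD s - D (s + 1))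
        \<bullet> (V - D (s + 1)) \<le> 0"
  shows "2 * (\<Sum>s = 1..t. gw s \<bullet> (w s - wp) + gD s \<bullet> (D s - Dp))
    \<le> u_bound \<sigma> \<Lambda> \<eta> w D gw gD t wp Dp"
proof -
  define a where "a s = (norm (w s - wp))\<^sup>2 + (norm (avg_op (D s) - Dp))\<^sup>2" for s
  have "2 * (gw s \<bullet> (w s - wp) + gD s \<bullet> (D s - Dp)) \<le> (a s - a (s + 1)) / \<eta> s
      + 6 * (\<eta> s * ((norm (gw s))\<^sup>2 + (norm (gD s))\<^sup>2))
      + 2 * (2 + \<sigma> * \<Lambda>) * (norm (gD s) * norm (disagreement_op (D s)))
      + 2 * norm (disagreement_op Dp) * norm (gD s)" if "s \<in> {1..t}" for s
  proof -
    have s: "1 \<le> s" using that by simp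
    have "2 * (gw s \<bullet> (w s - wp)) \<le>
        ((norm (w s - wp))\<^sup>2 - (norm (w (s + 1) - wp))\<^sup>2) / \<eta> s + 6 * \<eta> s * (norm (gw s))\<^sup>2"
      using s p by (intro projected_step \<eta> proj_w)
    moreover have "2 * (gD s \<bullet> (D s - Dp)) \<le>
        ((norm (avg_op (D s) - Dp))\<^sup>2 - (norm (avg_op (D (s + 1)) - Dp))\<^sup>2) / \<eta> s
        + 6 * \<eta> s * (norm (gD s))\<^sup>2
        + 2 * (2 + \<sigma> * \<Lambda>) * (norm (gD s) * norm (disagreement_op (D s)))
        + 2 * norm (disagreement_op Dp) * norm (gD s)"
      using s by (intro projected_consensus_step[OF ds \<open>convex C\<close> \<Lambda> \<open>0 < \<sigma>\<close> \<eta> D p(2) proj_D])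
    ultimately show ?thesis
      by (simp add: a_def add_divide_distrib diff_divide_distrib distrib_left)
  qed
  then have "(\<Sum>s = 1..t. 2 * (gw s \<bullet> (w s - wp) + gD s \<bullet> (D s - Dp)))
      \<le> (\<Sum>s = 1..t. (a s - a (s + 1)) / \<eta> s
        + 6 * (\<eta> s * ((norm (gw s))\<^sup>2 + (norm (gD s))\<^sup>2))
        + 2 * (2 + \<sigma> * \<Lambda>) * (norm (gD s) * norm (disagreement_op (D s)))
        + 2 * norm (disagreement_op Dp) * norm (gD s))"
    by (rule sum_mono)
  also have "\<dots> = (\<Sum>s = 1..t. (a s - a (s + 1)) / \<eta> s)
      + 6 * (\<Sum>s = 1..t. \<eta> s * ((norm (gw s))\<^sup>2 + (norm (gD s))\<^sup>2))
      + 2 * (2 + \<sigma> * \<Lambda>) * (\<Sum>s = 1..t. norm (gD s) * norm (disagreement_op (D s)))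
      + 2 * norm (disagreement_op Dp) * (\<Sum>s = 1..t. norm (gD s))"
    unfolding sum.distrib sum_distrib_left ..
  finally have regret: "2 * (\<Sum>s = 1..t. gw s \<bullet> (w s - wp) + gD s \<bullet> (D s - Dp))
      \<le> (\<Sum>s = 1..t. (a s - a (s + 1)) / \<eta> s)
      + 6 * (\<Sum>s = 1..t. \<eta> s * ((norm (gw s))\<^sup>2 + (norm (gD s))\<^sup>2))
      + 2 * (2 + \<sigma> * \<Lambda>) * (\<Sum>s = 1..t. norm (gD s) * norm (disagreement_op (D s)))
      + 2 * norm (disagreement_op Dp) * (\<Sum>s = 1..t. norm (gD s))"
    by (simp only: sum_distrib_left)
  have "(\<Sum>s = 1..t. (a s - a (s + 1)) / \<eta> s)
      \<le> a 1 / \<eta> 1 + (\<Sum>s = 2..t. a s * (1 / \<eta> s - 1 / \<eta> (s - 1)))"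
    using \<open>1 \<le> t\<close> \<eta> by (intro sum_divide_telescope_le) (auto simp: a_def)
  \<comment> \<open>The initial distances are split by the parallelogram bound, which gives the
    factor 2; averaging does not increase the norm of \<open>D 1\<close>.\<close>
  moreover have "a 1 / \<eta> 1
      \<le> 2 / \<eta> 1 * ((norm (w 1))\<^sup>2 + (norm wp)\<^sup>2 + (norm (D 1))\<^sup>2 + (norm Dp)\<^sup>2)"
  proof -
    have avg: "(norm (avg_op (D 1) - Dp))\<^sup>2 \<le> 2 * ((norm (D 1))\<^sup>2 + (norm Dp)\<^sup>2)"
      by (rule order_trans[OF norm_diff_sq_le]) (simp add: norm_avg_op_le power_mono)
    have "a 1 \<le> 2 * ((norm (w 1))\<^sup>2 + (norm wp)\<^sup>2 + (norm (D 1))\<^sup>2 + (norm Dp)\<^sup>2)"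
      using add_mono[OF norm_diff_sq_le[of "w 1" wp] avg]
      unfolding a_def distrib_left by (simp only: add.assoc)
    then show ?thesis
      using \<eta>[of 1] by (simp add: divide_right_mono)
  qed
  ultimately show ?thesis
    using regret unfolding u_bound_def a_def by linarith
qed

section \<open>Time averages and regret of convex functions\<close>

lemma time_avg_Pair: "time_avg (\<lambda>s. (x s, y s)) t = (time_avg x t, time_avg y t)"
  by (simp add: time_avg_def sum_prod)

lemma time_avg_in_convex:
  assumes "convex C" and "1 \<le> t" and "\<And>s. 1 \<le> s \<Longrightarrow> x s \<in> C"
  shows "time_avg x t \<in> C"
  unfolding time_avg_def scaleR_sum_right using assms by (intro convex_sum) auto

lemma convex_on_time_avg:
  assumes "convex_on C f" and "1 \<le> t" and "\<And>s. 1 \<le> s \<Longrightarrow> x s \<in> C"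
  shows "real t * f (time_avg x t) \<le> (\<Sum>s = 1..t. f (x s))"
proof -
  have "f (time_avg x t) \<le> (\<Sum>s = 1..t. 1 / real t * f (x s))"
    unfolding time_avg_def scaleR_sum_right using assms by (intro convex_on_sum[of _ C]) auto
  also have "\<dots> = (\<Sum>s = 1..t. f (x s)) / real t"
    by (simp add: sum_divide_distrib)
  finally show ?thesis
    using \<open>1 \<le> t\<close> by (simp add: field_simps)
qed

text \<open>The subgradient inequality at each iterate reduces function gaps to first-order terms.
  The objective \<open>f s\<close> varies with \<open>s\<close> because the opposing player's
  iterates enter it.\<close>

lemma regret_le_u_bound:
  fixes w gw :: "nat \<Rightarrow> 'a::real_inner" and D gD :: "nat \<Rightarrow> 'b::euclidean_space ^ 'n"
    and f :: "nat \<Rightarrow> 'a \<Rightarrow> 'b ^ 'n \<Rightarrow> real"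
  assumes "1 \<le> t" and "convex C" and "0 < \<sigma>"
    and "\<And>s. 1 \<le> s \<Longrightarrow> 0 < \<eta> s"
    and "\<And>s. 1 \<le> s \<Longrightarrow> doubly_stochastic (mat 1 - \<sigma> *\<^sub>R laplacian (A s))"
    and "\<And>s. 1 \<le> s \<Longrightarrow> sigma_max (laplacian (A s)) \<le> \<Lambda>"
    and "\<And>s. 1 \<le> s \<Longrightarrow> D s \<in> agent_product C"
    and p: "wp \<in> W" "Dp \<in> agent_product C"
    and "\<And>s v. 1 \<le> s \<Longrightarrow> v \<in> W \<Longrightarrow>
      (w s - \<eta> s *\<^sub>R gw s - w (s + 1)) \<bullet> (v - w (s + 1)) \<le> 0"
    and "\<And>s V. 1 \<le> s \<Longrightarrow> V \<in> agent_product C \<Longrightarrow>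
      (D s - \<sigma> *\<^sub>R kron_id (laplacian (A s)) (D s) - \<eta> s *\<^sub>R gD s - D (s + 1))
        \<bullet> (V - D (s + 1)) \<le> 0"
    and sub: "\<And>s. 1 \<le> s \<Longrightarrow>
      (gw s, gD s) \<in> subgradients (W \<times> agent_product C) (\<lambda>(v, X). f s v X) (w s, D s)"
  shows "2 * (\<Sum>s = 1..t. f s (w s) (D s)) - 2 * (\<Sum>s = 1..t. f s wp Dp)
    \<le> u_bound \<sigma> \<Lambda> \<eta> w D gw gD t wp Dp"
proof -
  have "f s (w s) (D s) - f s wp Dp \<le> gw s \<bullet> (w s - wp) + gD s \<bullet> (D s - Dp)"
    if "s \<in> {1..t}" for s
  proof -
    have "f s (w s) (D s) + (gw s \<bullet> (wp - w s) + gD s \<bullet> (Dp - D s)) \<le> f s wp Dp"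
      using sub[of s] that p by (auto simp: subgradients_def)
    then show ?thesis by (simp add: inner_diff_right)
  qed
  then have "(\<Sum>s = 1..t. f s (w s) (D s) - f s wp Dp)
      \<le> (\<Sum>s = 1..t. gw s \<bullet> (w s - wp) + gD s \<bullet> (D s - Dp))"
    by (rule sum_mono)
  moreover have "2 * (\<Sum>s = 1..t. gw s \<bullet> (w s - wp) + gD s \<bullet> (D s - Dp))
      \<le> u_bound \<sigma> \<Lambda> \<eta> w D gw gD t wp Dp"
    by (rule first_order_regret_le_u_bound) fact+
  ultimately show ?thesis by (simp add: sum_subtractf)
qed

text \<open>Lets the dual ascent be treated as descent for the negated objective at the same
  bound.\<close>

lemma u_bound_uminus:
  "u_bound \<sigma> \<Lambda> \<eta> w D (\<lambda>s. - gw s) (\<lambda>s. - gD s) t wp Dp = u_bound \<sigma> \<Lambda> \<eta> w D gw gD t wp Dp"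
  by (simp add: u_bound_def)

section \<open>The feasible set and the saddle-point bounds\<close>

lemma agent_product_eq: "agent_product C = (\<Inter>i. (\<lambda>X. X $ i) -` C)"
  by (auto simp: agent_product_def)

lemma closed_agent_product: "closed C \<Longrightarrow> closed (agent_product C)"
  for C :: "'a::topological_space set"
  unfolding agent_product_eq
  by (intro closed_INT ballI closed_vimage continuous_intros)

lemma convex_agent_product: "convex C \<Longrightarrow> convex (agent_product C)"
  by (auto simp: convex_def agent_product_def)

text \<open>The suprema live in \<open>ereal\<close>, so they are meaningful for unbounded families
  too. Unbounded degrees have inverse 0, which excludes every positive \<open>\<sigma>\<close>;
  degrees that all vanish have inverse \<infinity> and impose no restriction.\<close>

theorem mainTheorem3:
  fixes W :: "(real ^ 'dw) set" and DD :: "(real ^ 'dD) set"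
    and MM :: "(real ^ 'dm) set" and ZZ :: "(real ^ 'dz) set"
    and S :: "((real ^ 'dw) \<times> ((real ^ 'dD) ^ 'n) \<times> (real ^ 'dm) \<times> ((real ^ 'dz) ^ 'n)) set"
    and \<phi> :: "real ^ 'dw \<Rightarrow> (real ^ 'dD) ^ 'n \<Rightarrow> real ^ 'dm \<Rightarrow> (real ^ 'dz) ^ 'n \<Rightarrow> real"
    and A :: "nat \<Rightarrow> real ^ 'n ^ 'n"
    and \<sigma> \<Lambda> :: real and \<eta> :: "nat \<Rightarrow> real"
    and w gw :: "nat \<Rightarrow> real ^ 'dw" and D gD :: "nat \<Rightarrow> (real ^ 'dD) ^ 'n"
    and \<mu> g\<mu> :: "nat \<Rightarrow> real ^ 'dm" and z gz :: "nat \<Rightarrow> (real ^ 'dz) ^ 'n"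
    and w_star :: "real ^ 'dw" and D_star :: "(real ^ 'dD) ^ 'n"
    and \<mu>_star :: "real ^ 'dm" and z_star :: "(real ^ 'dz) ^ 'n"
    and t :: nat
  assumes "closed W" and "convex W" and "closed DD" and "convex DD"
    and "closed MM" and "convex MM" and "closed ZZ" and "convex ZZ"
    and S_eq: "S = W \<times> agent_product DD \<times> MM \<times> agent_product ZZ"
    and \<phi>_convex: "\<forall>m\<in>MM. \<forall>y\<in>agent_product ZZ.
          convex_on (W \<times> agent_product DD) (\<lambda>(v, X). \<phi> v X m y)"
    and \<phi>_concave: "\<forall>v\<in>W. \<forall>X\<in>agent_product DD.
          concave_on (MM \<times> agent_product ZZ) (\<lambda>(m, y). \<phi> v X m y)"
    and A_nonneg: "\<forall>s\<ge>1. \<forall>i j. 0 \<le> A s $ i $ j"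
    and A_balanced: "\<forall>s\<ge>1. weight_balanced (A s)"
    and \<Lambda>_bound: "(SUP s\<in>{1..}. ereal (sigma_max (laplacian (A s)))) \<le> ereal \<Lambda>"
    and \<sigma>_pos: "0 < \<sigma>"
    and \<sigma>_le: "ereal \<sigma> \<le> inverse (SUP (k, s)\<in>UNIV \<times> {1..}. ereal (out_degree (A s) k))"
    and \<eta>_pos: "\<forall>s\<ge>1. 0 < \<eta> s"
    and init: "(w 1, D 1, \<mu> 1, z 1) \<in> S"
    and primal_subgradients: "\<forall>s\<ge>1. (gw s, gD s) \<in>
          subgradients (W \<times> agent_product DD) (\<lambda>(v, X). \<phi> v X (\<mu> s) (z s)) (w s, D s)"
    and dual_subgradients: "\<forall>s\<ge>1. (g\<mu> s, gz s) \<in>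
          concave_subgradients (MM \<times> agent_product ZZ) (\<lambda>(m, y). \<phi> (w s) (D s) m y) (\<mu> s, z s)"
    and step: "\<forall>s\<ge>1. (w (s + 1), D (s + 1), \<mu> (s + 1), z (s + 1)) =
          closest_point S
            (w s - \<eta> s *\<^sub>R gw s,
             D s - \<sigma> *\<^sub>R kron_id (laplacian (A s)) (D s) - \<eta> s *\<^sub>R gD s,
             \<mu> s + \<eta> s *\<^sub>R g\<mu> s,
             z s - \<sigma> *\<^sub>R kron_id (laplacian (A s)) (z s) + \<eta> s *\<^sub>R gz s)"
    and saddle: "saddle_point_on S \<phi> w_star D_star \<mu>_star z_star"
    and agreement: "\<exists>d\<in>DD. \<exists>y\<in>ZZ. D_star = (\<chi> i. d) \<and> z_star = (\<chi> i. y)"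
    and t_ge: "1 \<le> t"
  shows "- u_bound \<sigma> \<Lambda> \<eta> \<mu> z g\<mu> gz t \<mu>_star z_star
           - u_bound \<sigma> \<Lambda> \<eta> w D gw gD t (time_avg w t) (time_avg D t)
         \<le> 2 * real t * \<phi> (time_avg w t) (time_avg D t) (time_avg \<mu> t) (time_avg z t)
           - 2 * real t * \<phi> w_star D_star \<mu>_star z_star
       \<and> 2 * real t * \<phi> (time_avg w t) (time_avg D t) (time_avg \<mu> t) (time_avg z t)
           - 2 * real t * \<phi> w_star D_star \<mu>_star z_star
         \<le> u_bound \<sigma> \<Lambda> \<eta> w D gw gD t w_star D_star
           + u_bound \<sigma> \<Lambda> \<eta> \<mu> z g\<mu> gz t (time_avg \<mu> t) (time_avg z t)"
proof -
  \<comment> \<open>The induction below rebinds \<open>step\<close> to its own case.\<close>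
  note dynamics = step
  have cvx: "convex S" and cl: "closed S"
    unfolding S_eq using assms(1-8)
    by (intro convex_Times closed_Times convex_agent_product closed_agent_product; simp)+
  have mem: "(w s, D s, \<mu> s, z s) \<in> S" if "1 \<le> s" for s
    using that
  proof (induction s rule: dec_induct)
    case base
    then show ?case by (rule init)
  next
    case (step n)
    have "S \<noteq> {}" using init by auto
    then have "(w (n + 1), D (n + 1), \<mu> (n + 1), z (n + 1)) \<in> S"
      using step.hyps dynamics cl by (simp add: closest_point_in_set)
    then show ?case by simp
  qed
  have w: "w s \<in> W" and D: "D s \<in> agent_product DD"
    and \<mu>: "\<mu> s \<in> MM" and z: "z s \<in> agent_product ZZ" if "1 \<le> s" for s
    using mem[OF that] by (auto simp: S_eq)
  \<comment> \<open>The variational inequality of the projection onto the product \<open>S\<close>,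
    split into four inner products. The dual steps are written as descent along negated
    gradients.\<close>
  have proj: "(w s - \<eta> s *\<^sub>R gw s - w (s + 1)) \<bullet> (v - w (s + 1))
      + (D s - \<sigma> *\<^sub>R kron_id (laplacian (A s)) (D s) - \<eta> s *\<^sub>R gD s - D (s + 1)) \<bullet> (X - D (s + 1))
      + (\<mu> s - \<eta> s *\<^sub>R (- g\<mu> s) - \<mu> (s + 1)) \<bullet> (m - \<mu> (s + 1))
      + (z s - \<sigma> *\<^sub>R kron_id (laplacian (A s)) (z s) - \<eta> s *\<^sub>R (- gz s) - z (s + 1)) \<bullet> (y - z (s + 1))
      \<le> 0"
    if "1 \<le> s" "v \<in> W" "X \<in> agent_product DD" "m \<in> MM" "y \<in> agent_product ZZ" for s v X m y
  proof -
    have "(v, X, m, y) \<in> S" using that by (simp add: S_eq)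
    from closest_point_dot[OF cvx cl this, of
        "(w s - \<eta> s *\<^sub>R gw s, D s - \<sigma> *\<^sub>R kron_id (laplacian (A s)) (D s) - \<eta> s *\<^sub>R gD s,
          \<mu> s + \<eta> s *\<^sub>R g\<mu> s, z s - \<sigma> *\<^sub>R kron_id (laplacian (A s)) (z s) + \<eta> s *\<^sub>R gz s)"]
    show ?thesis
      unfolding dynamics[rule_format, OF that(1), symmetric] by (simp add: add.assoc)
  qed
  \<comment> \<open>Testing with the next iterate in three of the four components makes their inner
    products vanish, which isolates the inequality for the remaining one.\<close>
  have next_mem: "w (s + 1) \<in> W" "D (s + 1) \<in> agent_product DD"
    "\<mu> (s + 1) \<in> MM" "z (s + 1) \<in> agent_product ZZ" for s
    by (simp_all add: w D \<mu> z)
  have proj_w: "(w s - \<eta> s *\<^sub>R gw s - w (s + 1)) \<bullet> (v - w (s + 1)) \<le> 0"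
    if "1 \<le> s" "v \<in> W" for s v
    using proj[OF that next_mem(2,3,4)[of s]] by simp
  have proj_D: "(D s - \<sigma> *\<^sub>R kron_id (laplacian (A s)) (D s) - \<eta> s *\<^sub>R gD s - D (s + 1))
      \<bullet> (X - D (s + 1)) \<le> 0" if "1 \<le> s" "X \<in> agent_product DD" for s X
    using proj[OF that(1) next_mem(1)[of s] that(2) next_mem(3,4)[of s]] by simp
  have proj_\<mu>: "(\<mu> s - \<eta> s *\<^sub>R (- g\<mu> s) - \<mu> (s + 1)) \<bullet> (m - \<mu> (s + 1)) \<le> 0"
    if "1 \<le> s" "m \<in> MM" for s m
    using proj[OF that(1) next_mem(1,2)[of s] that(2) next_mem(4)[of s]] by simp
  have proj_z: "(z s - \<sigma> *\<^sub>R kron_id (laplacian (A s)) (z s) - \<eta> s *\<^sub>R (- gz s) - z (s + 1))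
      \<bullet> (y - z (s + 1)) \<le> 0" if "1 \<le> s" "y \<in> agent_product ZZ" for s y
    using proj[OF that(1) next_mem(1,2,3)[of s] that(2)] by simp

  have \<eta>: "0 < \<eta> s" if "1 \<le> s" for s
    using \<eta>_pos that by blast
  have \<Lambda>: "sigma_max (laplacian (A s)) \<le> \<Lambda>" if "1 \<le> s" for s
    using \<Lambda>_bound that by (simp add: SUP_le_iff)
  have deg: "\<sigma> * out_degree (A s) k \<le> 1" if "1 \<le> s" for s k
  proof -
    define M where "M = (SUP (k, s)\<in>UNIV \<times> {1..}. ereal (out_degree (A s) k))"
    have "ereal (out_degree (A s) k) \<le> M"
      unfolding M_def using that by (intro SUP_upper2[of "(k, s)"]) auto
    moreover have "ereal \<sigma> \<le> inverse M"
      using \<sigma>_le by (simp add: M_def)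
    moreover have "0 \<le> out_degree (A s) k"
      using A_nonneg that by (auto simp: out_degree_def intro: sum_nonneg)
    ultimately show ?thesis
      using \<sigma>_pos
    \<comment> \<open>An infinite \<open>M\<close> has inverse 0, contradicting
      \<open>0 < \<sigma>\<close>. The finite value 0 is separate, since its inverse is \<infinity>;
      there the degree itself is 0.\<close>
    proof (cases M)
      case (real r)
      then have r: "out_degree (A s) k \<le> r" "0 \<le> r"
        using \<open>ereal (out_degree (A s) k) \<le> M\<close> \<open>0 \<le> out_degree (A s) k\<close> by auto
      show ?thesis
      proof (cases "r = 0")
        case True
        then show ?thesis using r \<open>0 \<le> out_degree (A s) k\<close> by simp
      next
        case False
        then have "\<sigma> * r \<le> 1"
          using \<open>ereal \<sigma> \<le> inverse M\<close> real r by (simp add: field_simps)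
        moreover have "\<sigma> * out_degree (A s) k \<le> \<sigma> * r"
          using r \<sigma>_pos by (intro mult_left_mono) auto
        ultimately show ?thesis by linarith
      qed
    qed auto
  qed
  have ds: "doubly_stochastic (mat 1 - \<sigma> *\<^sub>R laplacian (A s))" if "1 \<le> s" for s
    using that A_nonneg A_balanced \<sigma>_pos deg by (intro doubly_stochastic_laplacian_step) auto

  \<comment> \<open>\<open>F\<close> occurs with opposite signs in the primal and dual regrets, so
    it cancels when they are added.\<close>
  define F where "F = (\<Sum>s = 1..t. \<phi> (w s) (D s) (\<mu> s) (z s))"
  have primal: "2 * F - 2 * (\<Sum>s = 1..t. \<phi> v X (\<mu> s) (z s)) \<le> u_bound \<sigma> \<Lambda> \<eta> w D gw gD t v X"
    if "v \<in> W" "X \<in> agent_product DD" for v X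
    unfolding F_def
    using regret_le_u_bound[where f = "\<lambda>s v X. \<phi> v X (\<mu> s) (z s)"
        and w = w and D = D and gw = gw and gD = gD and \<eta> = \<eta> and A = A,
        OF t_ge \<open>convex DD\<close> \<sigma>_pos \<eta> ds \<Lambda> D that proj_w proj_D] primal_subgradients
    by blast
  have dual: "2 * (\<Sum>s = 1..t. \<phi> (w s) (D s) m y) - 2 * F \<le> u_bound \<sigma> \<Lambda> \<eta> \<mu> z g\<mu> gz t m y"
    if "m \<in> MM" "y \<in> agent_product ZZ" for m y
  proof -
    have "(- g\<mu> s, - gz s) \<in> subgradients (MM \<times> agent_product ZZ)
        (\<lambda>(m, y). - \<phi> (w s) (D s) m y) (\<mu> s, z s)" if "1 \<le> s" for s
      using dual_subgradients that by (simp add: concave_subgradients_def case_prod_beta')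
    from regret_le_u_bound[where f = "\<lambda>s m y. - \<phi> (w s) (D s) m y"
        and w = \<mu> and D = z and gw = "\<lambda>s. - g\<mu> s" and gD = "\<lambda>s. - gz s" and \<eta> = \<eta> and A = A,
        OF t_ge \<open>convex ZZ\<close> \<sigma>_pos \<eta> ds \<Lambda> z that proj_\<mu> proj_z this]
    show ?thesis
      by (simp add: F_def sum_negf u_bound_uminus)
  qed

  have av: "time_avg w t \<in> W" "time_avg D t \<in> agent_product DD"
      "time_avg \<mu> t \<in> MM" "time_avg z t \<in> agent_product ZZ"
    using assms(1-8) t_ge w D \<mu> z by (auto intro!: time_avg_in_convex convex_agent_product)
  have jensen_primal: "real t * \<phi> (time_avg w t) (time_avg D t) m y
      \<le> (\<Sum>s = 1..t. \<phi> (w s) (D s) m y)" if "m \<in> MM" "y \<in> agent_product ZZ" for m y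
    using convex_on_time_avg[OF \<phi>_convex[rule_format, OF that] t_ge, of "\<lambda>s. (w s, D s)"] w D
    by (simp add: time_avg_Pair)
  have jensen_dual: "(\<Sum>s = 1..t. \<phi> v X (\<mu> s) (z s))
      \<le> real t * \<phi> v X (time_avg \<mu> t) (time_avg z t)" if "v \<in> W" "X \<in> agent_product DD" for v X
    using convex_on_time_avg[OF \<phi>_concave[rule_format, OF that, unfolded concave_on_def] t_ge,
        of "\<lambda>s. (\<mu> s, z s)"] \<mu> z
    by (simp add: time_avg_Pair sum_negf)

  have star: "w_star \<in> W" "D_star \<in> agent_product DD" "\<mu>_star \<in> MM" "z_star \<in> agent_product ZZ"
    using saddle by (auto simp: saddle_point_on_def S_eq)
  have "\<phi> w_star D_star (time_avg \<mu> t) (time_avg z t) \<le> \<phi> w_star D_star \<mu>_star z_star"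
    and "\<phi> w_star D_star \<mu>_star z_star \<le> \<phi> (time_avg w t) (time_avg D t) \<mu>_star z_star"
    using saddle av by (auto simp: saddle_point_on_def S_eq)
  then have "real t * \<phi> w_star D_star (time_avg \<mu> t) (time_avg z t)
      \<le> real t * \<phi> w_star D_star \<mu>_star z_star"
    and "real t * \<phi> w_star D_star \<mu>_star z_star
      \<le> real t * \<phi> (time_avg w t) (time_avg D t) \<mu>_star z_star"
    by (auto intro: mult_left_mono)
  \<comment> \<open>Upper bound: pass from the averages to sums by \<open>jensen_primal\<close>, to
    \<open>F\<close> by \<open>dual\<close> at the dual averages, to the saddle point by
    \<open>primal\<close>, then \<open>jensen_dual\<close> and the left saddle inequality. The lower
    bound is the mirror image, with \<open>primal\<close> at the primal averages and
    \<open>dual\<close> at the saddle point.\<close>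
  then show ?thesis
    using primal[OF star(1,2)] jensen_dual[OF star(1,2)]
      dual[OF star(3,4)] jensen_primal[OF star(3,4)]
      primal[OF av(1,2)] jensen_dual[OF av(1,2)]
      dual[OF av(3,4)] jensen_primal[OF av(3,4)]
    by linarith
qed

end
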